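(* Let $F$, $\mathcal{R}$, $u_0$, $u^\dagger$, $R=\mathcal{R}(u^\dagger)<\infty$ and the topologies $\mathcal{T}_{\mathcal{U}},\mathcal{T}_{\mathcal{Y}}$ satisfy Assumption A (defined in the context), and let $$\|F(\bar u)-F(u)-F'(u)(\bar u-u)\|\le c_{tc}\|F(\bar u)-F(u)\|\qquad\text{for all }\bar u,u\in B_R$$ hold with some $c_{tc}<1/3$. Let $(g^\delta)_{\delta>0}\subset\mathcal{Y}$ satisfy $\|g-g^\delta\|\le\delta$, let $\tau>\frac{1+c_{tc}}{1-3c_{tc}}$, and let $0<c_{tc}+\frac{1+c_{tc}}{\tau}<\theta<\Theta<1-2c_{tc}<1$. Let $u^*\in B_R$ be a solution of $F(u)=g$ with $\partial\mathcal{R}(u^* )\neq\emptyset$ at which the following variational source condition holds with some index function $\phi:\mathbb{R}^+\to\mathbb{R}^+$ (i.e. $\phi$ is monotonically increasing and $\lim_{t\to0}\phi(t)=0$): there exist $\epsilon^\dagger\in\partial\mathcal{R}(u^* )$ and $\beta\in[0,1)$ such that for all $\tilde u\in B_{\mathcal{R}(u^* )}$ $$-\langle\epsilon^\dagger,\tilde u-u^*\rangle\le\beta D_{\epsilon^\dagger}(\tilde u,u^* )+\phi(\|F(\tilde u)-F(u^* )\|).$$ Then the output $u^\delta_{k_*(\delta,g^\delta)}$ of the Ivanov-IRGN method (see context) satisfies $$D_{\epsilon^\dagger}(u^\delta_{k_*(\delta,g^\delta)},u^* )\le\frac{1}{1-\beta}\,\phi((\tau+1)\delta).$$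
   Context: Setting. $\mathcal{U},\mathcal{Y}$ are real Banach spaces, $F:\mathcal{D}(F)\subset\mathcal{U}\to\mathcal{Y}$ is a possibly nonlinear operator, $g\in\mathcal{Y}$ is the exact data, and the equation to be solved is $F(u)=g$. $\mathcal{R}$ is a regularization functional with values in $[0,\infty]$, $u_0\in\mathcal{D}(F)$ is an a priori guess, and for $r\ge0$, $B_r=\{u\in\mathcal{D}(F):\mathcal{R}(u)\le r\}$. For $u\in B_R$, $F'(u)\in L(\mathcal{U},\mathcal{Y})$ is some bounded linear operator, called a linearization of $F$ (not necessarily a Gateaux or Frechet derivative; only the tangential cone condition and Assumption A are required of it). Assumption A. A solution $u^\dagger\in\mathcal{D}(F)$ of $F(u)=g$ exists with $R:=\mathcal{R}(u^\dagger)<\infty$, and there exist topologies $\mathcal{T}_{\mathcal{U}}$ on $\mathcal{U}$ and $\mathcal{T}_{\mathcal{Y}}$ on $\mathcal{Y}$ (typically weak or weak* topologies) such that: (a) $\mathcal{R}\ge0$ is proper, convex and $\mathcal{T}_{\mathcal{U}}$-lower semicontinuous, with $\mathcal{R}(u)=0\iff u=u_0$; (b) for all $0\le r\le\mathcal{R}(u^\dagger)$ the set $B_r$ is (sequentially) compact with respect to $\mathcal{T}_{\mathcal{U}}$; (c) bounded sets in $\mathcal{Y}$ are relatively (sequentially) $\mathcal{T}_{\mathcal{Y}}$-compact, and the norm of $\mathcal{Y}$ is $\mathcal{T}_{\mathcal{Y}}$-lower semicontinuous; (d) for all $u\in B_R$ the linear operator $F'(u)$ is $\mathcal{T}_{\mathcal{U}}$-to-$\mathcal{T}_{\mathcal{Y}}$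 closed: for any sequence $(u_k)\subseteq\mathcal{U}$, if $u_k\to\bar u$ in $\mathcal{T}_{\mathcal{U}}$ and $F'(u)u_k\to y$ in $\mathcal{T}_{\mathcal{Y}}$, then $F'(u)\bar u=y$. Ivanov-IRGN method. Given $g^\delta$, $\delta$ and constants $\tau,\theta,\Theta$, set $u_0^\delta=u_0$. While $\|F(u_k^\delta)-g^\delta\|>\tau\delta$: for a radius $\rho$ let $$u_{k+1}^\delta(\rho)\in\operatorname{argmin}\{\|F'(u_k^\delta)(u-u_k^\delta)+F(u_k^\delta)-g^\delta\| : u\in\mathcal{D}(F),\ \mathcal{R}(u)\le\rho\},$$ choose $\rho=\rho_k$ such that $$\theta\|F(u_k^\delta)-g^\delta\|\le\|F'(u_k^\delta)(u_{k+1}^\delta(\rho)-u_k^\delta)+F(u_k^\delta)-g^\delta\|\le\Theta\|F(u_k^\delta)-g^\delta\|,$$ and set $u_{k+1}^\delta:=u_{k+1}^\delta(\rho_k)$. The output is $u^\delta_{k_*(\delta,g^\delta)}$, where $k_*(\delta,g^\delta)=\min\{k\in\mathbb{N}_0:\|F(u_k^\delta)-g^\delta\|\le\tau\delta\}$. Bregman distance: for $\epsilon$ in the subdifferential $\partial\mathcal{R}(u)$, $D_\epsilon(\tilde u,u)=\mathcal{R}(\tilde u)-\mathcal{R}(u)-\langle\epsilon,\tilde u-u\rangle$. *)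

theory Defs
  imports "HOL-Analysis.Analysis"
begin

section \<open>Sequential and semicontinuity notions for an abstract topology\<close>

definition seq_compactin :: "'a topology \<Rightarrow> 'a set \<Rightarrow> bool" where
  "seq_compactin T S \<longleftrightarrow> S \<subseteq> topspace T \<and>
     (\<forall>x :: nat \<Rightarrow> 'a. (\<forall>n. x n \<in> S) \<longrightarrow>
        (\<exists>l\<in>S. \<exists>r :: nat \<Rightarrow> nat. strict_mono r \<and> limitin T (x \<circ> r) l sequentially))"

definition relatively_seq_compactin :: "'a topology \<Rightarrow> 'a set \<Rightarrow> bool" where
  "relatively_seq_compactin T S \<longleftrightarrow> S \<subseteq> topspace T \<and>
     (\<forall>x :: nat \<Rightarrow> 'a. (\<forall>n. x n \<in> S) \<longrightarrow>
        (\<exists>l\<in>topspace T. \<exists>r :: nat \<Rightarrow> nat. strict_mono r \<and> limitin T (x \<circ> r) l sequentially))"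

definition lower_semicontinuous_map :: "'a topology \<Rightarrow> ('a \<Rightarrow> 'b::linorder) \<Rightarrow> bool" where
  "lower_semicontinuous_map T f \<longleftrightarrow> (\<forall>c. closedin T {x \<in> topspace T. f x \<le> c})"


section \<open>Convex functionals with values in \<open>[0,\<infinity>]\<close>\<close>

text \<open>Functionals are \<open>ereal\<close>-valued so that the differences in the Bregman distance are
  available; nonnegativity is imposed explicitly in \<open>assumption_A\<close>.\<close>

definition proper_functional :: "('a \<Rightarrow> ereal) \<Rightarrow> bool" where
  "proper_functional R \<longleftrightarrow> (\<forall>u. R u \<noteq> -\<infinity>) \<and> (\<exists>u. R u \<noteq> \<infinity>)"

definition convex_functional :: "('a::real_vector \<Rightarrow> ereal) \<Rightarrow> bool" where
  "convex_functional R \<longleftrightarrow>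
     (\<forall>u v. \<forall>t\<in>{0<..<1}. R ((1 - t) *\<^sub>R u + t *\<^sub>R v) \<le> ereal (1 - t) * R u + ereal t * R v)"

text \<open>The subdifferential is a set of bounded linear functionals; it is empty where \<open>R\<close> is
  not finite.\<close>

definition subdifferential :: "('a::real_normed_vector \<Rightarrow> ereal) \<Rightarrow> 'a \<Rightarrow> ('a \<Rightarrow>\<^sub>L real) set" where
  "subdifferential R u =
     {e. \<bar>R u\<bar> \<noteq> \<infinity> \<and> (\<forall>v. R u + ereal (blinfun_apply e (v - u)) \<le> R v)}"

definition bregman_distance ::
  "('a::real_normed_vector \<Rightarrow> ereal) \<Rightarrow> ('a \<Rightarrow>\<^sub>L real) \<Rightarrow> 'a \<Rightarrow> 'a \<Rightarrow> ereal" where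
  "bregman_distance R e v u = R v - R u - ereal (blinfun_apply e (v - u))"

text \<open>Only the values on \<open>[0,\<infinity>)\<close> matter.\<close>

definition index_function :: "(real \<Rightarrow> real) \<Rightarrow> bool" where
  "index_function \<phi> \<longleftrightarrow>
     (\<forall>t\<ge>0. 0 \<le> \<phi> t) \<and> mono_on {0..} \<phi> \<and> (\<phi> \<longlongrightarrow> 0) (at_right 0)"


section \<open>The setting\<close>

text \<open>The operator \<open>F\<close> is a total function of which only the restriction to the domain \<open>DF\<close> is
  used; likewise the linearization \<open>F' u\<close> is relevant only for \<open>u\<close> in \<open>B\<^sub>R\<close>.\<close>

definition B_set :: "'u set \<Rightarrow> ('u \<Rightarrow> ereal) \<Rightarrow> ereal \<Rightarrow> 'u set" where
  "B_set DF R r = {u \<in> DF. R u \<le> r}"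

definition assumption_A ::
  "'u::banach topology \<Rightarrow> 'y::banach topology \<Rightarrow> 'u set \<Rightarrow> ('u \<Rightarrow> 'y) \<Rightarrow> ('u \<Rightarrow> ('u \<Rightarrow>\<^sub>L 'y)) \<Rightarrow>
   ('u \<Rightarrow> ereal) \<Rightarrow> 'u \<Rightarrow> 'y \<Rightarrow> 'u \<Rightarrow> bool" where
  "assumption_A TU TY DF F F' R u0 g udag \<longleftrightarrow>
     udag \<in> DF \<and> F udag = g \<and> R udag < \<infinity> \<and>
     topspace TU = UNIV \<and> topspace TY = UNIV \<and>
     (\<forall>u. 0 \<le> R u) \<and> proper_functional R \<and> convex_functional R \<and>
     lower_semicontinuous_map TU R \<and> (\<forall>u. R u = 0 \<longleftrightarrow> u = u0) \<and>
     (\<forall>r. 0 \<le> r \<and> r \<le> R udag \<longrightarrow> seq_compactin TU (B_set DF R r)) \<and>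
     (\<forall>S :: 'y set. bounded S \<longrightarrow> relatively_seq_compactin TY S) \<and>
     lower_semicontinuous_map TY (norm :: 'y \<Rightarrow> real) \<and>
     (\<forall>u \<in> B_set DF R (R udag). \<forall>(x :: nat \<Rightarrow> 'u) xbar y.
        limitin TU x xbar sequentially \<and>
        limitin TY (\<lambda>k. blinfun_apply (F' u) (x k)) y sequentially \<longrightarrow>
        blinfun_apply (F' u) xbar = y)"

definition tangential_cone_condition ::
  "('u::real_normed_vector \<Rightarrow> 'y::real_normed_vector) \<Rightarrow> ('u \<Rightarrow> ('u \<Rightarrow>\<^sub>L 'y)) \<Rightarrow> 'u set \<Rightarrow> real \<Rightarrow> bool" where
  "tangential_cone_condition F F' B ctc \<longleftrightarrow>
     (\<forall>ubar\<in>B. \<forall>u\<in>B.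
        norm (F ubar - F u - blinfun_apply (F' u) (ubar - u)) \<le> ctc * norm (F ubar - F u))"

definition variational_source_condition ::
  "('u::real_normed_vector \<Rightarrow> 'y::real_normed_vector) \<Rightarrow> 'u set \<Rightarrow> ('u \<Rightarrow> ereal) \<Rightarrow> 'u \<Rightarrow>
   ('u \<Rightarrow>\<^sub>L real) \<Rightarrow> real \<Rightarrow> (real \<Rightarrow> real) \<Rightarrow> bool" where
  "variational_source_condition F DF R us e \<beta> \<phi> \<longleftrightarrow>
     (\<forall>v \<in> B_set DF R (R us).
        ereal (- blinfun_apply e (v - us))
          \<le> ereal \<beta> * bregman_distance R e v us + ereal (\<phi> (norm (F v - F us))))"


section \<open>The Ivanov-regularized Gauss-Newton method\<close>

definition lin_residual ::
  "('u::real_normed_vector \<Rightarrow> 'y::real_normed_vector) \<Rightarrow> ('u \<Rightarrow> ('u \<Rightarrow>\<^sub>L 'y)) \<Rightarrow> 'y \<Rightarrow> 'u \<Rightarrow> 'u \<Rightarrow> real" where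
  "lin_residual F F' gd u v = norm (blinfun_apply (F' u) (v - u) + F u - gd)"

text \<open>Minimizers need not be unique and more than one radius may be admissible, so a step of the
  method is a relation rather than a function.\<close>

definition ivanov_step ::
  "('u::real_normed_vector \<Rightarrow> 'y::real_normed_vector) \<Rightarrow> ('u \<Rightarrow> ('u \<Rightarrow>\<^sub>L 'y)) \<Rightarrow> 'u set \<Rightarrow>
   ('u \<Rightarrow> ereal) \<Rightarrow> 'y \<Rightarrow> real \<Rightarrow> real \<Rightarrow> 'u \<Rightarrow> 'u \<Rightarrow> bool" where
  "ivanov_step F F' DF R gd \<theta> \<Theta> u v \<longleftrightarrow>
     (\<exists>\<rho>::real. 0 \<le> \<rho> \<and>
        is_arg_min (lin_residual F F' gd u) (\<lambda>w. w \<in> B_set DF R (ereal \<rho>)) v \<and>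
        \<theta> * norm (F u - gd) \<le> lin_residual F F' gd u v \<and>
        lin_residual F F' gd u v \<le> \<Theta> * norm (F u - gd))"

text \<open>The step relation is required as long as the discrepancy principle has not yet been met; what
  follows in the sequence after the stopping index is irrelevant and left arbitrary.\<close>

definition ivanov_irgn ::
  "('u::real_normed_vector \<Rightarrow> 'y::real_normed_vector) \<Rightarrow> ('u \<Rightarrow> ('u \<Rightarrow>\<^sub>L 'y)) \<Rightarrow> 'u set \<Rightarrow>
   ('u \<Rightarrow> ereal) \<Rightarrow> 'u \<Rightarrow> 'y \<Rightarrow> real \<Rightarrow> real \<Rightarrow> real \<Rightarrow> real \<Rightarrow> (nat \<Rightarrow> 'u) \<Rightarrow> bool" where
  "ivanov_irgn F F' DF R u0 gd \<delta> \<tau> \<theta> \<Theta> u \<longleftrightarrow>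
     u 0 = u0 \<and>
     (\<forall>k. (\<forall>j\<le>k. norm (F (u j) - gd) > \<tau> * \<delta>) \<longrightarrow>
          ivanov_step F F' DF R gd \<theta> \<Theta> (u k) (u (Suc k)))"

definition stopping_index ::
  "('u \<Rightarrow> 'y::real_normed_vector) \<Rightarrow> 'y \<Rightarrow> real \<Rightarrow> real \<Rightarrow> (nat \<Rightarrow> 'u) \<Rightarrow> nat" where
  "stopping_index F gd \<delta> \<tau> u = (LEAST k. norm (F (u k) - gd) \<le> \<tau> * \<delta>)"

end

theory Submission
  imports Defs
begin

text \<open>A solution of \<open>F u = g\<close> in \<open>B\<^sub>R\<close> is never admissible for an Ivanov step before the
  discrepancy principle holds: by the tangential cone condition its linearized residual lies below
  the lower bound that the choice of the radius prescribes. Hence every chosen radius is smaller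
  than \<open>R ustar\<close>, and all iterates stay in the ball of radius \<open>R ustar\<close>. The upper bound in the
  choice of the radius makes the residuals contract by the factor \<open>(c\<^sub>t\<^sub>c + \<Theta>) / (1 - c\<^sub>t\<^sub>c) < 1\<close>, so
  the method stops, and at the stopping index the source condition gives the rate because \<open>R\<close> does
  not exceed \<open>R ustar\<close> there.\<close>

lemma ivanov_step_in_B_set:
  fixes R :: "'u::real_normed_vector \<Rightarrow> ereal" and F :: "'u \<Rightarrow> 'y::real_normed_vector"
  assumes tcc: "tangential_cone_condition F F' B c" and mem: "u \<in> B" "us \<in> B" "us \<in> DF"
    and noise: "norm (F us - gd) \<le> \<delta>" and c: "0 \<le> c" and \<tau>: "0 < \<tau>"
    and \<theta>: "c + (1 + c) / \<tau> < \<theta>"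
    and res: "\<tau> * \<delta> < norm (F u - gd)"
    and step: "ivanov_step F F' DF R gd \<theta> \<Theta> u v"
  shows "v \<in> B_set DF R (R us)"
proof -
  obtain \<rho> where arg: "is_arg_min (lin_residual F F' gd u) (\<lambda>w. w \<in> B_set DF R (ereal \<rho>)) v"
    and low: "\<theta> * norm (F u - gd) \<le> lin_residual F F' gd u v"
    using step unfolding ivanov_step_def by blast
  define r where "r = norm (F u - gd)"
  have "0 \<le> \<delta>"
    using noise norm_ge_zero order_trans by blast
  then have "0 < r"
    using res \<tau> unfolding r_def by (smt (verit) mult_nonneg_nonneg)
  \<comment> \<open>The linearized residual at \<open>us\<close> splits into the data error of
    \<open>us\<close> and the linearization error between \<open>u\<close> and \<open>us\<close>,
    which the tangential cone condition controls.\<close>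
  have "lin_residual F F' gd u us
      = norm ((F us - gd) - (F us - F u - blinfun_apply (F' u) (us - u)))"
    unfolding lin_residual_def by (rule arg_cong[of _ _ norm]) simp
  also have "\<dots> \<le> \<delta> + c * norm (F us - F u)"
    using tcc mem noise unfolding tangential_cone_condition_def
    by (intro order_trans[OF norm_triangle_ineq4 add_mono]) auto
  also have "\<dots> \<le> \<delta> + c * (\<delta> + r)"
    using norm_triangle_ineq4[of "F us - gd" "F u - gd"] noise c unfolding r_def
    by (intro add_left_mono mult_left_mono) auto
  also have "\<dots> = c * r + (1 + c) * \<delta>"
    by (simp add: algebra_simps)
  \<comment> \<open>The discrepancy principle is not yet met, so
    \<open>\<delta> < r / \<tau>\<close>. This turns noise into a fraction of the residual and
    produces the lower bound required of \<open>\<theta>\<close>.\<close>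
  also have "\<dots> \<le> c * r + (1 + c) * (r / \<tau>)"
    using res c \<tau> unfolding r_def
    by (intro add_left_mono mult_left_mono) (auto simp: field_simps)
  also have "\<dots> = (c + (1 + c) / \<tau>) * r"
    by (simp add: field_simps)
  also have "\<dots> < \<theta> * r"
    using \<theta> \<open>0 < r\<close> by simp
  finally have "lin_residual F F' gd u us < lin_residual F F' gd u v"
    using low unfolding r_def by simp
  then have "us \<notin> B_set DF R (ereal \<rho>)"
    using arg unfolding is_arg_min_def by blast
  \<comment> \<open>As \<open>us\<close> lies in \<open>DF\<close>, only the constraint on
    \<open>R\<close> can have failed.\<close>
  then have "ereal \<rho> \<le> R us"
    using mem unfolding B_set_def by auto
  then show ?thesis
    using arg unfolding is_arg_min_def B_set_def by auto
qed

text \<open>The new residual is the linearization error plus the linearized residual. The cone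
  condition bounds the former by \<open>c\<close> times the sum of the old and new residuals; since
  \<open>c < 1\<close>, the new one can be absorbed on the left.\<close>

lemma ivanov_step_residual_le:
  fixes R :: "'u::real_normed_vector \<Rightarrow> ereal" and F :: "'u \<Rightarrow> 'y::real_normed_vector"
  assumes tcc: "tangential_cone_condition F F' B c" and mem: "u \<in> B" "v \<in> B"
    and c: "0 \<le> c" "c < 1"
    and step: "ivanov_step F F' DF R gd \<theta> \<Theta> u v"
  shows "norm (F v - gd) \<le> (c + \<Theta>) / (1 - c) * norm (F u - gd)"
proof -
  have up: "lin_residual F F' gd u v \<le> \<Theta> * norm (F u - gd)"
    using step unfolding ivanov_step_def by blast
  have "norm (F v - gd) = norm ((F v - F u - blinfun_apply (F' u) (v - u))
      + (blinfun_apply (F' u) (v - u) + F u - gd))"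
    by simp
  also have "\<dots> \<le> c * norm (F v - F u) + \<Theta> * norm (F u - gd)"
    using tcc mem up unfolding tangential_cone_condition_def lin_residual_def
    by (intro norm_triangle_le add_mono) auto
  also have "\<dots> \<le> c * (norm (F v - gd) + norm (F u - gd)) + \<Theta> * norm (F u - gd)"
    using norm_triangle_ineq4[of "F v - gd" "F u - gd"] c
    by (intro add_right_mono mult_left_mono) auto
  finally show ?thesis
    using c by (simp add: field_simps)
qed

text \<open>Because \<open>R v\<close> does not exceed \<open>R us\<close>, the Bregman distance is
  at most the linear term that the source condition estimates. Its multiple by
  \<open>\<beta> < 1\<close> is then absorbed.\<close>

lemma bregman_distance_le_if_source_condition:
  assumes vsc: "variational_source_condition F DF R us e \<beta> \<phi>" and \<beta>: "\<beta> < 1"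
    and fin: "\<bar>R us\<bar> \<noteq> \<infinity>" and v: "v \<in> B_set DF R (R us)" "0 \<le> R v"
    and \<phi>: "mono_on {0..} \<phi>" and res: "norm (F v - F us) \<le> t"
  shows "bregman_distance R e v us \<le> ereal (1 / (1 - \<beta>) * \<phi> t)"
proof -
  obtain a where a: "R us = ereal a"
    using fin by auto
  obtain b where b: "R v = ereal b" "b \<le> a"
    using v a unfolding B_set_def by (cases "R v") auto
  define D where "D = b - a - blinfun_apply e (v - us)"
  have D: "bregman_distance R e v us = ereal D"
    unfolding bregman_distance_def D_def a b by simp
  have "ereal (- blinfun_apply e (v - us))
      \<le> ereal \<beta> * bregman_distance R e v us + ereal (\<phi> (norm (F v - F us)))"
    using vsc v(1) unfolding variational_source_condition_def by blast
  then have "- blinfun_apply e (v - us) \<le> \<beta> * D + \<phi> (norm (F v - F us))"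
    unfolding D by simp
  moreover have "\<phi> (norm (F v - F us)) \<le> \<phi> t"
    using res order_trans[OF norm_ge_zero res] by (intro mono_onD[OF \<phi>]) auto
  ultimately have "D \<le> \<beta> * D + \<phi> t"
    using b(2) unfolding D_def by linarith
  then show ?thesis
    using \<beta> unfolding D by (simp add: field_simps)
qed

theorem corollary2p4:
  fixes F :: "'u::banach \<Rightarrow> 'y::banach"
    and DF :: "'u set"
    and F' :: "'u \<Rightarrow> ('u \<Rightarrow>\<^sub>L 'y)"
    and R :: "'u \<Rightarrow> ereal"
    and u0 udag ustar :: 'u
    and g :: 'y
    and gd :: "real \<Rightarrow> 'y"
    and TU :: "'u topology"
    and TY :: "'y topology"
    and ctc \<tau> \<theta> \<Theta> \<beta> :: real
    and \<phi> :: "real \<Rightarrow> real"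
    and edag :: "'u \<Rightarrow>\<^sub>L real"
  assumes u0: "u0 \<in> DF"
    and A: "assumption_A TU TY DF F F' R u0 g udag"
    and tcc: "tangential_cone_condition F F' (B_set DF R (R udag)) ctc"
    and ctc: "ctc < 1/3"
    and noise: "\<And>\<delta>. \<delta> > 0 \<Longrightarrow> norm (g - gd \<delta>) \<le> \<delta>"
    and tau: "\<tau> > (1 + ctc) / (1 - 3 * ctc)"
    and theta: "0 < ctc + (1 + ctc) / \<tau>" "ctc + (1 + ctc) / \<tau> < \<theta>" "\<theta> < \<Theta>"
      "\<Theta> < 1 - 2 * ctc" "1 - 2 * ctc < 1"
    and ustar: "ustar \<in> B_set DF R (R udag)" "F ustar = g" "subdifferential R ustar \<noteq> {}"
    and phi: "index_function \<phi>"
    and edag: "edag \<in> subdifferential R ustar"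
    and beta: "0 \<le> \<beta>" "\<beta> < 1"
    and vsc: "variational_source_condition F DF R ustar edag \<beta> \<phi>"
  shows "\<forall>\<delta>>0. \<forall>u :: nat \<Rightarrow> 'u. ivanov_irgn F F' DF R u0 (gd \<delta>) \<delta> \<tau> \<theta> \<Theta> u \<longrightarrow>
           (\<exists>k. norm (F (u k) - gd \<delta>) \<le> \<tau> * \<delta>) \<and>
           bregman_distance R edag (u (stopping_index F (gd \<delta>) \<delta> \<tau> u)) ustar
             \<le> ereal (1 / (1 - \<beta>) * \<phi> ((\<tau> + 1) * \<delta>))"
proof (intro allI impI)
  fix \<delta> :: real and u :: "nat \<Rightarrow> 'u"
  assume \<delta>: "0 < \<delta>" and irgn: "ivanov_irgn F F' DF R u0 (gd \<delta>) \<delta> \<tau> \<theta> \<Theta> u"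
  define r where "r k = norm (F (u k) - gd \<delta>)" for k
  define B where "B = B_set DF R (R udag)"
  define q where "q = (ctc + \<Theta>) / (1 - ctc)"
  have c: "0 < ctc"
    using theta by simp
  have "0 < (1 + ctc) / (1 - 3 * ctc)"
    using c ctc by (intro divide_pos_pos) auto
  then have \<tau>: "0 < \<tau>"
    using tau by linarith
  \<comment> \<open>The bound \<open>q < 1\<close> is exactly
    \<open>\<Theta> < 1 - 2 * ctc\<close>.\<close>
  have q: "0 \<le> q" "q < 1"
    using c ctc theta unfolding q_def by (auto simp: field_simps)
  have R: "\<And>w. 0 \<le> R w" "R u0 = 0"
    using A unfolding assumption_A_def by auto
  have ball: "B_set DF R (R ustar) \<subseteq> B" and usB: "ustar \<in> B" "ustar \<in> DF"
    using ustar(1) unfolding B_def B_set_def by auto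
  have step: "ivanov_step F F' DF R (gd \<delta>) \<theta> \<Theta> (u k) (u (Suc k))" if "\<forall>j\<le>k. \<tau> * \<delta> < r j" for k
    using irgn that unfolding ivanov_irgn_def r_def by blast
  \<comment> \<open>Only indices strictly below \<open>k\<close> have to violate the discrepancy
    principle, so the claim also covers the stopping index itself.\<close>
  have iter: "u k \<in> B_set DF R (R ustar)" if "\<forall>j<k. \<tau> * \<delta> < r j" for k
    using that
  proof (induction k)
    case 0
    then show ?case
      using irgn u0 R unfolding ivanov_irgn_def B_set_def by auto
  next
    case (Suc k)
    have "\<forall>j\<le>k. \<tau> * \<delta> < r j"
      using Suc.prems by (simp add: less_Suc_eq_le)
    moreover have "u k \<in> B"
      using Suc ball by auto
    moreover have "norm (F ustar - gd \<delta>) \<le> \<delta>"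
      using noise[OF \<delta>] ustar(2) by simp
    ultimately show ?case
      using ivanov_step_in_B_set[OF tcc[folded B_def] _ usB _ _ \<tau> theta(2) _ step] c
      unfolding r_def by auto
  qed
  have ex: "\<exists>k. r k \<le> \<tau> * \<delta>"
  proof (rule ccontr)
    assume "\<nexists>k. r k \<le> \<tau> * \<delta>"
    then have all: "\<tau> * \<delta> < r k" for k
      by (simp add: not_le)
    \<comment> \<open>If the method never stopped, every step would be a genuine Ivanov step between
      points of \<open>B\<close>, so the contraction would hold for all \<open>k\<close>.\<close>
    have "r (Suc k) \<le> q * r k" for k
      using ivanov_step_residual_le[OF tcc[folded B_def] _ _ _ _ step] iter ball all c ctc
      unfolding r_def q_def by (simp add: subset_iff)
    then have "r k \<le> q ^ k * r 0" for k
    proof (induction k)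
      case (Suc k)
      have "r (Suc k) \<le> q * r k"
        by (rule Suc.prems)
      also have "\<dots> \<le> q * (q ^ k * r 0)"
        using Suc q by (intro mult_left_mono) auto
      finally show ?case
        by (simp add: mult.assoc)
    qed simp
    \<comment> \<open>A fixed positive number would lie below a geometric null sequence.\<close>
    then have "\<tau> * \<delta> \<le> q ^ k * r 0" for k
      using all[of k] by (meson less_imp_le order_trans)
    moreover have "(\<lambda>k. q ^ k * r 0) \<longlonglongrightarrow> 0"
      using q by (intro tendsto_mult_left_zero LIMSEQ_power_zero) auto
    ultimately have "\<tau> * \<delta> \<le> 0"
      by (intro LIMSEQ_le_const) auto
    then show False
      using \<tau> \<delta> by (simp add: mult_le_0_iff)
  qed
  define n where "n = stopping_index F (gd \<delta>) \<delta> \<tau> u"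
  have n_Least: "n = (LEAST k. r k \<le> \<tau> * \<delta>)"
    unfolding n_def stopping_index_def r_def by (rule refl)
  have n: "r n \<le> \<tau> * \<delta>" "\<forall>j<n. \<tau> * \<delta> < r j"
    unfolding n_Least using LeastI_ex[OF ex] not_less_Least not_le by blast+
  \<comment> \<open>Passing through the noisy data gives the argument of \<open>\<phi>\<close>:
    \<open>\<tau> * \<delta>\<close> from the stopping rule and \<open>\<delta>\<close> from the
    noise.\<close>
  have "norm (F (u n) - F ustar) \<le> r n + norm (g - gd \<delta>)"
    using norm_triangle_ineq4[of "F (u n) - gd \<delta>" "g - gd \<delta>"] ustar(2) unfolding r_def by simp
  then have "norm (F (u n) - F ustar) \<le> (\<tau> + 1) * \<delta>"
    using n noise[OF \<delta>] by (simp add: algebra_simps)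
  then have "bregman_distance R edag (u n) ustar \<le> ereal (1 / (1 - \<beta>) * \<phi> ((\<tau> + 1) * \<delta>))"
    using edag phi iter[OF n(2)] R beta unfolding subdifferential_def index_function_def
    by (intro bregman_distance_le_if_source_condition[OF vsc]) auto
  then show "(\<exists>k. norm (F (u k) - gd \<delta>) \<le> \<tau> * \<delta>) \<and>
           bregman_distance R edag (u (stopping_index F (gd \<delta>) \<delta> \<tau> u)) ustar
             \<le> ereal (1 / (1 - \<beta>) * \<phi> ((\<tau> + 1) * \<delta>))"
    using ex unfolding r_def n_def by blast
qed

end
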